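(* Let $\lambda$ satisfy Hypothesis (A) of the context and let $\omega(r,\mu,\varepsilon)$ be a smooth real-valued function. Consider the system $$0=\lambda(r_n,\mu)r_n+\mathrm{i}(\omega(r_n,\mu,\varepsilon)-\rho)r_n+\varepsilon\left(r_{n+1}\mathrm{e}^{\mathrm{i}\phi_n}-2r_n+r_{n-1}\mathrm{e}^{-\mathrm{i}\phi_{n-1}}\right),\qquad 1\le n\le N, \qquad (\ast)$$ for $(\boldsymbol r,\boldsymbol\phi,\rho)\in\mathbb{R}^N\times\mathbb{R}^{N-1}\times\mathbb{R}$, with the on-site or off-site boundary conditions of the context. (i) Assume that there is a $\mu\in(0,1)$ with $\omega(r_-(\mu),\mu,0)\ne\omega(r_+(\mu),\mu,0)$. Then there is an $\varepsilon_*>0$ so that $(\ast)$ cannot have a solution $\boldsymbol r$ for which there are indices $i,j$ with $r_i=r_+(\mu)$ and $r_j=r_-(\mu)$ for any $\varepsilon\in(0,\varepsilon_* )$. The same argument applies to each closed interval $I$ of $(0,1)$ for which $\omega(r_-(\mu),\mu,0)\neq\omega(r_+(\mu),\mu,0)$ uniformly in $\mu\in I$. (ii) Assume that $\omega(r,\mu,\varepsilon)=\omega_0(\mu)+\varepsilon\omega_1(r,\mu,\varepsilon)$. If there is a $\mu\in(0,1)$ with $$|\omega_1(r_-(\mu),\mu,0)-\omega_1(r_+(\mu),\mu,0)|>\frac{r_+(\mu)}{r_-(\mu)},$$ then there are constants $k_*\ge0$ and $\varepsilon_*>0$ so that $(\ast)$ cannot have solutions near $$\boldsymbol r=(r_+(\mu),\dots,r_+(\mu),r_-(\mu),0,\dots,0)\in\mathbb{R}^N$$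 that starts with $k$ contiguous values of $r_+(\mu)$, for any $k\ge k_*$ and any $\varepsilon\in(0,\varepsilon_* )$.
   Context: The system $(\ast)$ describes time-periodic solutions $Z_n(t)=\mathrm{e}^{\mathrm{i}\rho t}r_n\mathrm{e}^{\mathrm{i}\theta_n}$ of a chain of $N$ coupled oscillators with dissipative nearest-neighbor coupling of strength $\varepsilon$. Here $\boldsymbol r=(r_n)_{1\le n\le N}$ are the real amplitudes, $\boldsymbol\phi=(\phi_n)_{1\le n\le N-1}$ with $\phi_n=\theta_{n+1}-\theta_n$ are the real phase differences, and $\rho$ is the temporal frequency. Boundary conditions: at the left end either on-site, $(r_0,\phi_0):=(r_2,-\phi_1)$, or off-site, $(r_0,\phi_0):=(r_1,0)$; at the right end $(r_{N+1},\phi_N):=(r_N,0)$. Hypothesis (A). The function $\lambda:\mathbb{R}^2\to\mathbb{R}$, $(r,\mu)\mapsto\lambda(r,\mu)$, is smooth and satisfies: - $\lambda(-r,\mu)=\lambda(r,\mu)$; - for each $\mu\in(0,1)$, $\lambda(\cdot,\mu)$ has exactly two nontrivial positive roots $r=r_\pm(\mu)$, with $0<r_-(\mu)<r_+(\mu)$; - for each $\mu\in(0,1)$, $\lambda(0,\mu)<0$ and $\lambda_r(r_+(\mu),\mu)<0<\lambda_r(r_-(\mu),\mu)$; - at $\mu=0$ the roots $r=0$ and $r=\pm r_-(\mu)$ of the function $r\lambda(r,\mu)$ collide in a generic subcritical pitchfork bifurcation; - at $\mu=1$ the roots $r=r_\pm(\mu)$ collide in a generic saddle-node bifurcation at $r=1$.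 In (ii), $\omega_0$ and $\omega_1$ are smooth real-valued functions. *)

theory Defs
  imports "HOL-Analysis.Analysis"
begin

text \<open>\<open>Ck k f\<close>: \<open>f\<close> is of class \<open>C\<^sup>k\<close> on its whole domain type, in the sense that all directional
  derivatives up to order \<open>k\<close> exist (as values of Frechet derivatives) and are continuous.\<close>

primrec Ck :: "nat \<Rightarrow> ('a::euclidean_space \<Rightarrow> real) \<Rightarrow> bool" where
  "Ck 0 f = continuous_on UNIV f"
| "Ck (Suc k) f = ((\<forall>x. f differentiable (at x)) \<and>
      (\<forall>v. Ck k (\<lambda>x. frechet_derivative f (at x) v)))"

definition smooth :: "('a::euclidean_space \<Rightarrow> real) \<Rightarrow> bool" where
  "smooth f \<longleftrightarrow> (\<forall>k. Ck k f)"

text \<open>The usual defining and nondegeneracy conditions for bifurcations of the zeros of a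
  one-parameter family \<open>F x \<mu>\<close> at \<open>(x, \<mu>) = (x0, \<mu>0)\<close>. For \<open>x' = F x \<mu>\<close> the bifurcating branch of a
  pitchfork is \<open>\<mu> - \<mu>0 \<approx> - F\<^sub>x\<^sub>x\<^sub>x / (6 F\<^sub>x\<^sub>\<mu>) (x - x0)\<^sup>2\<close>. It lies on the side of \<open>\<mu>0\<close> on which the
  trivial zero \<open>x0\<close> is stable, that is, the pitchfork is subcritical, iff \<open>F\<^sub>x\<^sub>x\<^sub>x > 0\<close>, whatever the
  sign of \<open>F\<^sub>x\<^sub>\<mu>\<close>.\<close>

definition generic_subcritical_pitchfork :: "(real \<Rightarrow> real \<Rightarrow> real) \<Rightarrow> real \<Rightarrow> real \<Rightarrow> bool" where
  "generic_subcritical_pitchfork F x0 \<mu>0 \<longleftrightarrow>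
     F x0 \<mu>0 = 0 \<and>
     deriv (\<lambda>x. F x \<mu>0) x0 = 0 \<and>
     deriv (\<lambda>\<mu>. F x0 \<mu>) \<mu>0 = 0 \<and>
     (deriv ^^ 2) (\<lambda>x. F x \<mu>0) x0 = 0 \<and>
     deriv (\<lambda>\<mu>. deriv (\<lambda>x. F x \<mu>) x0) \<mu>0 \<noteq> 0 \<and>
     (deriv ^^ 3) (\<lambda>x. F x \<mu>0) x0 > 0"

definition generic_saddle_node :: "(real \<Rightarrow> real \<Rightarrow> real) \<Rightarrow> real \<Rightarrow> real \<Rightarrow> bool" where
  "generic_saddle_node F x0 \<mu>0 \<longleftrightarrow>
     F x0 \<mu>0 = 0 \<and>
     deriv (\<lambda>x. F x \<mu>0) x0 = 0 \<and>
     deriv (\<lambda>\<mu>. F x0 \<mu>) \<mu>0 \<noteq> 0 \<and>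
     (deriv ^^ 2) (\<lambda>x. F x \<mu>0) x0 \<noteq> 0"

text \<open>Hypothesis (A) for \<open>\<lambda> = lam\<close> with roots \<open>r\<^sub>- = rm\<close> and \<open>r\<^sub>+ = rp\<close>. Only the values of \<open>rm\<close> and
  \<open>rp\<close> on \<open>(0,1)\<close> are relevant; there they are determined by \<open>lam\<close>.\<close>

definition hypothesis_A ::
  "(real \<Rightarrow> real \<Rightarrow> real) \<Rightarrow> (real \<Rightarrow> real) \<Rightarrow> (real \<Rightarrow> real) \<Rightarrow> bool" where
  "hypothesis_A lam rm rp \<longleftrightarrow>
     smooth (\<lambda>(r, \<mu>). lam r \<mu>) \<and>
     (\<forall>r \<mu>. lam (- r) \<mu> = lam r \<mu>) \<and>
     (\<forall>\<mu>\<in>{0<..<1}. 0 < rm \<mu> \<and> rm \<mu> < rp \<mu> \<and> {r. 0 < r \<and> lam r \<mu> = 0} = {rm \<mu>, rp \<mu>}) \<and>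
     (\<forall>\<mu>\<in>{0<..<1}. lam 0 \<mu> < 0 \<and>
        deriv (\<lambda>r. lam r \<mu>) (rp \<mu>) < 0 \<and> 0 < deriv (\<lambda>r. lam r \<mu>) (rm \<mu>)) \<and>
     generic_subcritical_pitchfork (\<lambda>r \<mu>. r * lam r \<mu>) 0 0 \<and>
     (rm \<longlongrightarrow> 0) (at_right 0) \<and>
     generic_saddle_node lam 1 1 \<and>
     (rm \<longlongrightarrow> 1) (at_left 1) \<and> (rp \<longlongrightarrow> 1) (at_left 1)"

datatype left_bc = On_Site | Off_Site

text \<open>Amplitudes and phase differences are indexed by \<open>nat\<close>. The boundary conditions determine
  \<open>r 0\<close>, \<open>\<phi> 0\<close>, \<open>r (N + 1)\<close> and \<open>\<phi> N\<close> from the unknowns \<open>r 1, \<dots>, r N\<close> and \<open>\<phi> 1, \<dots>, \<phi> (N - 1)\<close>;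
  values at larger indices play no role.\<close>

definition boundary_conditions ::
  "left_bc \<Rightarrow> nat \<Rightarrow> (nat \<Rightarrow> real) \<Rightarrow> (nat \<Rightarrow> real) \<Rightarrow> bool" where
  "boundary_conditions bc N r \<phi> \<longleftrightarrow>
     (case bc of On_Site \<Rightarrow> r 0 = r 2 \<and> \<phi> 0 = - \<phi> 1 | Off_Site \<Rightarrow> r 0 = r 1 \<and> \<phi> 0 = 0) \<and>
     r (N + 1) = r N \<and> \<phi> N = 0"

definition chain_solution ::
  "(real \<Rightarrow> real \<Rightarrow> real) \<Rightarrow> (real \<Rightarrow> real \<Rightarrow> real \<Rightarrow> real) \<Rightarrow> left_bc \<Rightarrow> nat \<Rightarrow> real \<Rightarrow> real \<Rightarrow>
   (nat \<Rightarrow> real) \<Rightarrow> (nat \<Rightarrow> real) \<Rightarrow> real \<Rightarrow> bool" where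
  "chain_solution lam \<omega> bc N \<mu> \<epsilon> r \<phi> \<rho> \<longleftrightarrow>
     boundary_conditions bc N r \<phi> \<and>
     (\<forall>n\<in>{1..N}. 0 =
        complex_of_real (lam (r n) \<mu> * r n)
        + \<i> * complex_of_real ((\<omega> (r n) \<mu> \<epsilon> - \<rho>) * r n)
        + complex_of_real \<epsilon> *
            (complex_of_real (r (n + 1)) * exp (\<i> * complex_of_real (\<phi> n))
             - 2 * complex_of_real (r n)
             + complex_of_real (r (n - 1)) * exp (- \<i> * complex_of_real (\<phi> (n - 1)))))"

text \<open>The profile \<open>(r\<^sub>+, \<dots>, r\<^sub>+, r\<^sub>-, 0, \<dots>, 0)\<close> with \<open>k\<close> leading entries \<open>r\<^sub>+\<close>, indexed from \<open>1\<close>.\<close>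

definition front_profile :: "real \<Rightarrow> real \<Rightarrow> nat \<Rightarrow> nat \<Rightarrow> real" where
  "front_profile r_plus r_minus k n =
     (if n \<le> k then r_plus else if n = k + 1 then r_minus else 0)"

end

theory Submission
  imports Defs
begin

text \<open>Each site equation splits into a real part and an imaginary part. By the real part at a site
  of maximal modulus, every amplitude satisfies \<open>\<bar>r\<^sub>n\<bar> \<le> r\<^sub>+\<close>, because \<open>\<lambda> < 0\<close> beyond \<open>r\<^sub>+\<close>. The imaginary
  parts at the sites with amplitudes \<open>r\<^sub>+\<close> and \<open>r\<^sub>-\<close> then put both \<open>\<omega>(r\<^sub>+)\<close> and \<open>\<omega>(r\<^sub>-)\<close> within \<open>O(\<epsilon>)\<close> of
  \<open>\<rho>\<close>, uniformly in \<open>N\<close>, which gives (i). For (ii), the imaginary part multiplied by \<open>r\<^sub>n\<close> is a balance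
  law for the flux \<open>r\<^sub>n r\<^sub>n\<^sub>+\<^sub>1 sin \<phi>\<^sub>n\<close>. Summed over the plateau, it forces \<open>(\<rho> - \<omega>\<^sub>0) / \<epsilon>\<close> to be within
  \<open>O(1/k)\<close> of \<open>\<omega>\<^sub>1(r\<^sub>+)\<close>, up to an error that vanishes with \<open>\<delta>\<close> and \<open>\<epsilon>\<close>, whereas the site with
  amplitude near \<open>r\<^sub>-\<close> keeps it within about \<open>r\<^sub>+ / r\<^sub>-\<close> of \<open>\<omega>\<^sub>1(r\<^sub>-)\<close>.\<close>

section \<open>Continuity and differentiability of sections of smooth functions\<close>

lemma smooth_imp_continuous_on: "smooth f \<Longrightarrow> continuous_on S f"
  using Ck.simps(1) smooth_def continuous_on_subset by blast

lemma smooth_imp_differentiable: "smooth f \<Longrightarrow> f differentiable (at x)"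
  using Ck.simps(2)[of 0 f] unfolding smooth_def by blast

lemma smooth_section_DERIV:
  assumes "smooth (\<lambda>(r, \<mu>). f r \<mu> :: real)"
  shows "((\<lambda>r. f r \<mu>) has_real_derivative deriv (\<lambda>r. f r \<mu>) x) (at x)"
proof -
  have "(\<lambda>(r, \<mu>). f r \<mu>) differentiable (at (x, \<mu>))"
    using assms by (rule smooth_imp_differentiable)
  moreover have "(\<lambda>r::real. (r, \<mu>)) differentiable (at x)"
    by (intro differentiable_Pair) auto
  ultimately have "((\<lambda>(r, \<mu>). f r \<mu>) \<circ> (\<lambda>r. (r, \<mu>))) differentiable (at x)"
    by (intro differentiable_chain_at) auto
  then have "(\<lambda>r. f r \<mu>) differentiable (at x)"
    by (simp add: o_def)
  then show ?thesis
    by (simp add: DERIV_deriv_iff_real_differentiable)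
qed

lemma isCont_imp_tendsto_nhds: "isCont f x \<Longrightarrow> (f \<longlongrightarrow> f x) (nhds x)"
  by (simp add: isCont_def tendsto_at_iff_tendsto_nhds)

lemma isCont_section:
  fixes f :: "'a::euclidean_space \<Rightarrow> 'b::euclidean_space \<Rightarrow> real"
  assumes "smooth (\<lambda>(r, \<mu>). f r \<mu>)"
  shows "isCont (\<lambda>r. f r \<mu>) x" "isCont (\<lambda>\<mu>. f x \<mu>) \<mu>"
proof -
  have *: "continuous_on UNIV (\<lambda>(r, \<mu>). f r \<mu>)"
    using assms by (rule smooth_imp_continuous_on)
  have "continuous_on UNIV (\<lambda>r::'a. (r, \<mu>))" "continuous_on UNIV (\<lambda>\<mu>::'b. (x, \<mu>))"
    by (intro continuous_intros)+
  then have "continuous_on UNIV (\<lambda>r. f r \<mu>)" "continuous_on UNIV (\<lambda>\<mu>. f x \<mu>)"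
    using continuous_on_compose2[OF *, of UNIV "\<lambda>r. (r, \<mu>)"]
      continuous_on_compose2[OF *, of UNIV "\<lambda>\<mu>. (x, \<mu>)"] by simp_all
  then show "isCont (\<lambda>r. f r \<mu>) x" "isCont (\<lambda>\<mu>. f x \<mu>) \<mu>"
    by (auto simp: continuous_on_eq_continuous_at)
qed

section \<open>Sign of \<lambda> and location of its roots under Hypothesis (A)\<close>

lemma hypothesis_A_roots_pos:
  assumes "hypothesis_A lam rm rp" "\<mu> \<in> {0<..<1}"
  shows "0 < rm \<mu>" "rm \<mu> < rp \<mu>" "0 < rp \<mu>"
proof -
  show "0 < rm \<mu>" "rm \<mu> < rp \<mu>"
    using assms unfolding hypothesis_A_def by blast+
  then show "0 < rp \<mu>"
    by (rule less_trans)
qed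

text \<open>Otherwise there would be a third positive root: the negative slope at
  \<open>rp \<mu>\<close> makes \<lambda> negative just to the right of it, and the intermediate
  value theorem then gives a zero between there and \<open>x\<close>.\<close>

lemma hypothesis_A_neg_beyond:
  assumes A: "hypothesis_A lam rm rp" and \<mu>: "\<mu> \<in> {0<..<1}" and x: "rp \<mu> < x"
  shows "lam x \<mu> < 0"
proof (rule ccontr)
  assume "\<not> lam x \<mu> < 0"
  have sm: "smooth (\<lambda>(r, \<mu>). lam r \<mu>)" and roots: "{r. 0 < r \<and> lam r \<mu> = 0} = {rm \<mu>, rp \<mu>}"
    and D: "deriv (\<lambda>r. lam r \<mu>) (rp \<mu>) < 0"
    using A \<mu> unfolding hypothesis_A_def by blast+
  note pos = hypothesis_A_roots_pos[OF A \<mu>]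
  have root: "lam (rp \<mu>) \<mu> = 0"
    using roots by blast
  obtain d where d: "d > 0" "\<And>h. h > 0 \<Longrightarrow> h < d \<Longrightarrow> lam (rp \<mu> + h) \<mu> < lam (rp \<mu>) \<mu>"
    using DERIV_neg_dec_right[OF smooth_section_DERIV[OF sm] D] by blast
  \<comment> \<open>Halving both distances gives a step below \<open>d\<close> that stops short of
    \<open>x\<close>.\<close>
  define h where "h = min (d / 2) ((x - rp \<mu>) / 2)"
  have h: "h > 0" "h < d" "rp \<mu> + h < x"
    using d(1) x by (auto simp: h_def min_def field_simps)
  have "lam (rp \<mu> + h) \<mu> \<le> 0" "0 \<le> lam x \<mu>"
    using d(2)[OF h(1,2)] root \<open>\<not> lam x \<mu> < 0\<close> by auto
  then obtain y where "rp \<mu> + h \<le> y" "lam y \<mu> = 0"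
    using IVT[of "\<lambda>r. lam r \<mu>" "rp \<mu> + h" 0 x] h isCont_section(1)[OF sm] by force
  then have "y \<in> {rm \<mu>, rp \<mu>}"
    unfolding roots[symmetric] using pos h by auto
  then show False
    using \<open>rp \<mu> + h \<le> y\<close> h pos by auto
qed

text \<open>Continuity of \<open>rm\<close> and \<open>rp\<close> inside \<open>(0,1)\<close> is not
  given, so the bounds rest on open sign conditions: \<lambda> is negative near 0, positive at some
  \<open>s\<close> below \<open>rp \<mu>\<close> and negative at some \<open>R\<close> above it.
  These persist for nearby parameters and trap the two roots.\<close>

lemma hypothesis_A_roots_locally_bounded:
  assumes A: "hypothesis_A lam rm rp" and \<mu>: "\<mu> \<in> {0<..<1}"
  shows "\<exists>c>0. \<exists>R. \<forall>\<^sub>F \<nu> in nhds \<mu>. c \<le> rm \<nu> \<and> rp \<nu> \<le> R"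
proof -
  have sm: "smooth (\<lambda>(r, \<mu>). lam r \<mu>)"
    and roots: "\<And>\<nu>. \<nu> \<in> {0<..<1} \<Longrightarrow> {r. 0 < r \<and> lam r \<nu> = 0} = {rm \<nu>, rp \<nu>}"
    and pos: "\<And>\<nu>. \<nu> \<in> {0<..<1} \<Longrightarrow> 0 < rm \<nu> \<and> rm \<nu> < rp \<nu>"
    and neg: "\<And>\<nu>. \<nu> \<in> {0<..<1} \<Longrightarrow> lam 0 \<nu> < 0"
    and D: "deriv (\<lambda>r. lam r \<mu>) (rp \<mu>) < 0"
    using A \<mu> unfolding hypothesis_A_def by blast+
  have root: "lam (rp \<mu>) \<mu> = 0"
    using roots[OF \<mu>] by blast
  obtain d where d: "d > 0" "\<And>h. h > 0 \<Longrightarrow> h < d \<Longrightarrow> lam (rp \<mu>) \<mu> < lam (rp \<mu> - h) \<mu>"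
    using DERIV_neg_dec_left[OF smooth_section_DERIV[OF sm] D] by blast
  \<comment> \<open>The cap \<open>d / 2\<close> keeps \<open>s\<close> where \<lambda> is positive;
    the cap \<open>rp \<mu> / 2\<close> keeps \<open>s\<close> itself positive.\<close>
  define s where "s = rp \<mu> - min (d / 2) (rp \<mu> / 2)"
  have s: "0 < s" "s < rp \<mu>" "0 < lam s \<mu>"
    using d pos[OF \<mu>] root unfolding s_def by (auto simp: min_def intro: d(2)[unfolded root])
  define R where "R = rp \<mu> + 1"
  have R: "lam R \<mu> < 0" "s < R"
    using hypothesis_A_neg_beyond[OF A \<mu>, of R] s by (auto simp: R_def)
  \<comment> \<open>Joint continuity provides one radius \<open>c\<close>, common to all nearby
    parameters, within which \<lambda> < 0; no root can lie there.\<close>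
  have "isCont (\<lambda>(r, \<mu>). lam r \<mu>) (0, \<mu>)"
    using smooth_imp_continuous_on[OF sm, of UNIV] by (simp add: continuous_on_eq_continuous_at)
  then have "\<forall>\<^sub>F p in nhds (0, \<mu>). (\<lambda>(r, \<mu>). lam r \<mu>) p < 0"
    using neg[OF \<mu>] by (intro order_tendstoD(2)[OF isCont_imp_tendsto_nhds]) auto
  then have "\<forall>\<^sub>F p in nhds (0::real) \<times>\<^sub>F nhds \<mu>. (\<lambda>(r, \<mu>). lam r \<mu>) p < 0"
    by (simp add: nhds_prod)
  then obtain P Q where P: "\<forall>\<^sub>F r in nhds 0. P r" and Q: "\<forall>\<^sub>F \<nu> in nhds \<mu>. Q \<nu>"
    and PQ: "\<And>r \<nu>. P r \<Longrightarrow> Q \<nu> \<Longrightarrow> lam r \<nu> < 0"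
    unfolding eventually_prod_filter by auto
  obtain c where c: "c > 0" "\<And>r. \<bar>r\<bar> < c \<Longrightarrow> P r"
    using P by (auto simp: eventually_nhds_metric)
  have "\<forall>\<^sub>F \<nu> in nhds \<mu>. lam s \<nu> > 0" "\<forall>\<^sub>F \<nu> in nhds \<mu>. lam R \<nu> < 0"
    using order_tendstoD[OF isCont_imp_tendsto_nhds[OF isCont_section(2)[OF sm]]] s R by auto
  moreover have "\<forall>\<^sub>F \<nu> in nhds \<mu>. \<nu> \<in> {0<..<1}"
    using \<mu> by (intro eventually_nhds_in_open) auto
  ultimately have "\<forall>\<^sub>F \<nu> in nhds \<mu>. c \<le> rm \<nu> \<and> rp \<nu> \<le> R"
    using Q
  proof eventually_elim
    case (elim \<nu>)
    have "lam (rm \<nu>) \<nu> = 0"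
      using roots[OF elim(3)] by blast
    then have "c \<le> rm \<nu>"
      using PQ[of "rm \<nu>" \<nu>] c(2)[of "rm \<nu>"] elim(4) pos[OF elim(3)] by force
    \<comment> \<open>The sign changes give a root \<open>y\<close> below \<open>s\<close> and a
      root \<open>z\<close> between \<open>s\<close> and \<open>R\<close>. Being distinct, they
      exhaust \<open>{rm \<nu>, rp \<nu>}\<close>, so \<open>rp \<nu>\<close> is the larger one,
      \<open>z\<close>.\<close>
    moreover obtain y where "0 \<le> y" "y \<le> s" "lam y \<nu> = 0"
      using IVT[of "\<lambda>r. lam r \<nu>" 0 0 s] neg[OF elim(3)] elim(1) s isCont_section(1)[OF sm] by force
    moreover obtain z where "s \<le> z" "z \<le> R" "lam z \<nu> = 0"
      using IVT2[of "\<lambda>r. lam r \<nu>" R 0 s] elim(1,2) s R isCont_section(1)[OF sm] by force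
    moreover have "y \<noteq> 0" "y \<noteq> s"
      using neg[OF elim(3)] elim(1) \<open>lam y \<nu> = 0\<close> by auto
    ultimately have "y \<in> {rm \<nu>, rp \<nu>}" "z \<in> {rm \<nu>, rp \<nu>}" "y < z"
      unfolding roots[OF elim(3), symmetric] by auto
    then have "rp \<nu> \<le> R"
      using pos[OF elim(3)] \<open>z \<le> R\<close> by auto
    then show ?case
      using \<open>c \<le> rm \<nu>\<close> by blast
  qed
  then show ?thesis
    using c by blast
qed

text \<open>Compactness in the form of Bolzano bisection: the local bounds hold on short intervals,
  and bounds on adjacent intervals merge by \<open>min\<close> and \<open>max\<close>.\<close>

lemma hypothesis_A_roots_bounded:
  assumes A: "hypothesis_A lam rm rp" and "0 < a" "a \<le> b" "b < 1"
  shows "\<exists>c>0. \<exists>R. \<forall>\<mu>\<in>{a..b}. c \<le> rm \<mu> \<and> rp \<mu> \<le> R"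
  using \<open>a \<le> b\<close>
proof (induction rule: Bolzano)
  case (trans x y z)
  then obtain c R c' R' where cR: "c > 0" "\<forall>\<mu>\<in>{x..y}. c \<le> rm \<mu> \<and> rp \<mu> \<le> R"
    "c' > 0" "\<forall>\<mu>\<in>{y..z}. c' \<le> rm \<mu> \<and> rp \<mu> \<le> R'"
    by blast
  have "min c c' \<le> rm \<mu> \<and> rp \<mu> \<le> max R R'" if "\<mu> \<in> {x..z}" for \<mu>
    using cR that by (cases "\<mu> \<le> y") (auto simp: min_le_iff_disj le_max_iff_disj)
  then show ?case
    using cR(1,3) by (metis min_less_iff_conj)
next
  case (local \<mu>)
  then obtain c R where "c > 0" "\<forall>\<^sub>F \<nu> in nhds \<mu>. c \<le> rm \<nu> \<and> rp \<nu> \<le> R"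
    using hypothesis_A_roots_locally_bounded[OF A, of \<mu>] assms by auto
  then obtain d where d: "d > 0" "\<And>\<nu>. \<bar>\<nu> - \<mu>\<bar> < d \<Longrightarrow> c \<le> rm \<nu> \<and> rp \<nu> \<le> R"
    by (auto simp: eventually_nhds_metric dist_real_def)
  have "\<forall>\<nu>\<in>{x..y}. c \<le> rm \<nu> \<and> rp \<nu> \<le> R" if "x \<le> \<mu> \<and> \<mu> \<le> y \<and> y - x < d" for x y
    using that by (auto intro!: d(2)[THEN conjunct1] d(2)[THEN conjunct2])
  then show ?case
    using d(1) \<open>c > 0\<close> by blast
qed

section \<open>Real and imaginary parts of the site equations and the resulting bounds\<close>

lemma chain_solution_Re_Im:
  assumes "chain_solution lam \<omega> bc N \<mu> \<epsilon> r \<phi> \<rho>" "n \<in> {1..N}"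
  shows "lam (r n) \<mu> * r n + \<epsilon> * (r (n + 1) * cos (\<phi> n) - 2 * r n + r (n - 1) * cos (\<phi> (n - 1))) = 0"
    and "(\<omega> (r n) \<mu> \<epsilon> - \<rho>) * r n + \<epsilon> * (r (n + 1) * sin (\<phi> n) - r (n - 1) * sin (\<phi> (n - 1))) = 0"
proof -
  let ?z = "complex_of_real (lam (r n) \<mu> * r n)
        + \<i> * complex_of_real ((\<omega> (r n) \<mu> \<epsilon> - \<rho>) * r n)
        + complex_of_real \<epsilon> *
            (complex_of_real (r (n + 1)) * exp (\<i> * complex_of_real (\<phi> n))
             - 2 * complex_of_real (r n)
             + complex_of_real (r (n - 1)) * exp (- \<i> * complex_of_real (\<phi> (n - 1))))"
  have "?z = 0"
    using assms unfolding chain_solution_def by metis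
  then have "Re ?z = 0" "Im ?z = 0"
    by simp_all
  then show "lam (r n) \<mu> * r n + \<epsilon> * (r (n + 1) * cos (\<phi> n) - 2 * r n + r (n - 1) * cos (\<phi> (n - 1))) = 0"
    and "(\<omega> (r n) \<mu> \<epsilon> - \<rho>) * r n + \<epsilon> * (r (n + 1) * sin (\<phi> n) - r (n - 1) * sin (\<phi> (n - 1))) = 0"
    by (simp_all add: Re_exp Im_exp)
qed

lemma boundary_conditions_neighbour_le:
  fixes r :: "nat \<Rightarrow> real"
  assumes bc: "boundary_conditions bc N r \<phi>" and n: "n \<in> {1..N}"
    and M: "\<And>m. m \<in> {1..N} \<Longrightarrow> \<bar>r m\<bar> \<le> M"
  shows "\<bar>r (n + 1)\<bar> \<le> M" "\<bar>r (n - 1)\<bar> \<le> M"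
proof -
  have last: "r (N + 1) = r N"
    using bc by (simp add: boundary_conditions_def)
  have succ: "\<bar>r (m + 1)\<bar> \<le> M" if "m \<in> {1..N}" for m
    using that M[of "m + 1"] M[of N] last by (cases "m = N") auto
  show "\<bar>r (n + 1)\<bar> \<le> M"
    using succ n .
  \<comment> \<open>For \<open>On_Site\<close> and \<open>N = 1\<close> the value \<open>r 2\<close>
    copied by \<open>r 0\<close> is itself the right ghost value; writing it as a successor lets
    \<open>succ\<close> cover this case as well.\<close>
  have "r 0 = r (1 + 1) \<or> r 0 = r 1"
    using bc by (auto simp: boundary_conditions_def numeral_2_eq_2 split: left_bc.splits)
  then have "\<bar>r 0\<bar> \<le> M"
    using succ[of 1] M[of 1] n by auto
  moreover have "n - 1 = 0 \<or> n - 1 \<in> {1..N}"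
    using n by auto
  ultimately show "\<bar>r (n - 1)\<bar> \<le> M"
    using M[of "n - 1"] by auto
qed

text \<open>Discrete maximum principle: at a site of maximal modulus the coupling multiplied by the
  amplitude is nonpositive, because no neighbour is larger in modulus. The real part therefore
  excludes \<lambda> < 0 there.\<close>

lemma chain_solution_abs_le:
  assumes A: "hypothesis_A lam rm rp" and \<mu>: "\<mu> \<in> {0<..<1}" and "\<epsilon> > 0"
    and sol: "chain_solution lam \<omega> bc N \<mu> \<epsilon> r \<phi> \<rho>" and n: "n \<in> {1..N}"
  shows "\<bar>r n\<bar> \<le> rp \<mu>"
proof -
  let ?S = "(\<lambda>m. \<bar>r m\<bar>) ` {1..N}"
  have "Max ?S \<in> ?S"
    using n by (intro Max_in) auto
  then obtain m where m: "m \<in> {1..N}" "Max ?S = \<bar>r m\<bar>"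
    by blast
  then have max: "\<bar>r j\<bar> \<le> \<bar>r m\<bar>" if "j \<in> {1..N}" for j
    using that Max_ge[of ?S "\<bar>r j\<bar>"] by auto
  have nb: "\<bar>r (m + 1)\<bar> \<le> \<bar>r m\<bar>" "\<bar>r (m - 1)\<bar> \<le> \<bar>r m\<bar>"
    using boundary_conditions_neighbour_le[of bc N r \<phi> m, OF _ m(1) max] sol
    by (auto simp: chain_solution_def)
  have mult_le: "r m * (x * cos t) \<le> (r m)\<^sup>2" if "\<bar>x\<bar> \<le> \<bar>r m\<bar>" for x t
  proof -
    have "r m * (x * cos t) \<le> \<bar>r m\<bar> * (\<bar>x\<bar> * \<bar>cos t\<bar>)"
      by (metis abs_ge_self abs_mult)
    also have "\<dots> \<le> \<bar>r m\<bar> * (\<bar>r m\<bar> * 1)"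
      using that by (intro mult_mono) auto
    finally show ?thesis
      by (simp add: power2_eq_square)
  qed
  have "\<bar>r m\<bar> \<le> rp \<mu>"
  proof (rule ccontr)
    assume "\<not> \<bar>r m\<bar> \<le> rp \<mu>"
    then have "lam \<bar>r m\<bar> \<mu> < 0"
      using hypothesis_A_neg_beyond[OF A \<mu>] by simp
    \<comment> \<open>Amplitudes may be negative; evenness of \<lambda> transfers the sign.\<close>
    moreover have "lam \<bar>r m\<bar> \<mu> = lam (r m) \<mu>"
      using A unfolding hypothesis_A_def by (metis abs_if)
    moreover have "r m \<noteq> 0"
      using \<open>\<not> \<bar>r m\<bar> \<le> rp \<mu>\<close> hypothesis_A_roots_pos(3)[OF A \<mu>] by auto
    ultimately have "lam (r m) \<mu> * (r m)\<^sup>2 < 0"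
      by (simp add: mult_neg_pos)
    \<comment> \<open>This is the real part at \<open>m\<close> multiplied by
      \<open>r m\<close>.\<close>
    moreover have "lam (r m) \<mu> * (r m)\<^sup>2 = \<epsilon> * (2 * (r m)\<^sup>2 - r m * (r (m + 1) * cos (\<phi> m))
        - r m * (r (m - 1) * cos (\<phi> (m - 1))))"
      using chain_solution_Re_Im(1)[OF sol m(1)] by algebra
    moreover have "\<dots> \<ge> 0"
      using mult_le[OF nb(1), of "\<phi> m"] mult_le[OF nb(2), of "\<phi> (m - 1)"] \<open>\<epsilon> > 0\<close>
      by (intro mult_nonneg_nonneg) auto
    ultimately show False
      by linarith
  qed
  then show ?thesis
    using max[OF n] by linarith
qed

text \<open>The imaginary part expresses the detuning through the two neighbours, each at most
  \<open>rp \<mu>\<close> in modulus. The bound is free of \<open>N\<close> and of the position of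
  the site.\<close>

lemma chain_solution_frequency_near:
  assumes A: "hypothesis_A lam rm rp" and \<mu>: "\<mu> \<in> {0<..<1}" and "\<epsilon> > 0"
    and sol: "chain_solution lam \<omega> bc N \<mu> \<epsilon> r \<phi> \<rho>" and n: "n \<in> {1..N}" and "r n > 0"
  shows "\<bar>\<omega> (r n) \<mu> \<epsilon> - \<rho>\<bar> \<le> 2 * \<epsilon> * rp \<mu> / r n"
proof -
  have bd: "\<bar>r (n + 1)\<bar> \<le> rp \<mu>" "\<bar>r (n - 1)\<bar> \<le> rp \<mu>"
    using boundary_conditions_neighbour_le[of bc N r \<phi> n, OF _ n chain_solution_abs_le[OF A \<mu> \<open>\<epsilon> > 0\<close> sol]] sol
    by (auto simp: chain_solution_def)
  have le: "\<bar>x * sin t\<bar> \<le> rp \<mu>" if "\<bar>x\<bar> \<le> rp \<mu>" for x t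
    using mult_mono[OF that abs_sin_le_one[of t]] that by (simp add: abs_mult)
  have "\<bar>\<omega> (r n) \<mu> \<epsilon> - \<rho>\<bar> * r n = \<bar>\<epsilon> * (r (n + 1) * sin (\<phi> n) - r (n - 1) * sin (\<phi> (n - 1)))\<bar>"
    using chain_solution_Re_Im(2)[OF sol n] \<open>r n > 0\<close>
    by (metis abs_minus_cancel abs_mult abs_of_pos add_eq_0_iff)
  also have "\<dots> = \<epsilon> * \<bar>r (n + 1) * sin (\<phi> n) - r (n - 1) * sin (\<phi> (n - 1))\<bar>"
    using \<open>\<epsilon> > 0\<close> by (simp add: abs_mult)
  also have "\<dots> \<le> \<epsilon> * (2 * rp \<mu>)"
    using le[OF bd(1), of "\<phi> n"] le[OF bd(2), of "\<phi> (n - 1)"] \<open>\<epsilon> > 0\<close>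
    by (intro mult_left_mono) auto
  finally show ?thesis
    using \<open>r n > 0\<close> by (simp add: field_simps)
qed

section \<open>Coexistence of both root amplitudes, as in (i)\<close>

text \<open>By the triangle inequality \<rho> cannot be within O(\<epsilon>) of two frequencies that
  are \<open>c\<close> apart. Bounds on the roots and uniform continuity of \<omega> on a compact
  box make the threshold uniform over the interval.\<close>

lemma no_mixed_solution_uniform:
  assumes A: "hypothesis_A lam rm rp"
    and cont: "continuous_on UNIV (\<lambda>(r, \<mu>, \<epsilon>). \<omega> r \<mu> \<epsilon> :: real)"
    and ab: "0 < a" "a \<le> b" "b < 1" and "c > 0"
    and c: "\<And>\<mu>. \<mu> \<in> {a..b} \<Longrightarrow> c \<le> \<bar>\<omega> (rm \<mu>) \<mu> 0 - \<omega> (rp \<mu>) \<mu> 0\<bar>"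
  obtains \<epsilon>s where "\<epsilon>s > 0"
    "\<And>\<mu> \<epsilon> bc N r \<phi> \<rho> i j. \<lbrakk>\<mu> \<in> {a..b}; \<epsilon> \<in> {0<..<\<epsilon>s}; chain_solution lam \<omega> bc N \<mu> \<epsilon> r \<phi> \<rho>;
      i \<in> {1..N}; j \<in> {1..N}; r i = rp \<mu>; r j = rm \<mu>\<rbrakk> \<Longrightarrow> False"
proof -
  obtain d R where "d > 0" and dR: "\<And>\<mu>. \<mu> \<in> {a..b} \<Longrightarrow> d \<le> rm \<mu> \<and> rp \<mu> \<le> R"
    using hypothesis_A_roots_bounded[OF A ab] by blast
  have pos: "0 < rm \<mu> \<and> rm \<mu> < rp \<mu>" if "\<mu> \<in> {a..b}" for \<mu>
    using hypothesis_A_roots_pos[OF A, of \<mu>] ab that by auto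
  have "R > 0"
    using dR[of a] pos[of a] ab by auto
  have "uniformly_continuous_on ({0..R} \<times> {a..b} \<times> {0..1}) (\<lambda>(r, \<mu>, \<epsilon>). \<omega> r \<mu> \<epsilon>)"
    using cont by (intro compact_uniformly_continuous compact_Times) (auto intro: continuous_on_subset)
  then obtain e where "e > 0" and e: "\<And>p q. p \<in> {0..R} \<times> {a..b} \<times> {0..1} \<Longrightarrow>
      q \<in> {0..R} \<times> {a..b} \<times> {0..1} \<Longrightarrow> dist q p < e \<Longrightarrow>
      dist ((\<lambda>(r, \<mu>, \<epsilon>). \<omega> r \<mu> \<epsilon>) q) ((\<lambda>(r, \<mu>, \<epsilon>). \<omega> r \<mu> \<epsilon>) p) < c / 4"
    unfolding uniformly_continuous_on_def using \<open>c > 0\<close> by (metis divide_pos_pos zero_less_numeral)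
  have close: "\<bar>\<omega> x \<mu> \<epsilon> - \<omega> x \<mu> 0\<bar> < c / 4"
    if "0 \<le> x" "x \<le> R" "\<mu> \<in> {a..b}" "0 < \<epsilon>" "\<epsilon> < min 1 e" for x \<mu> \<epsilon>
    using e[of "(x, \<mu>, 0)" "(x, \<mu>, \<epsilon>)"] that by (auto simp: dist_Pair_Pair dist_real_def)
  \<comment> \<open>The entries \<open>1\<close> and \<open>e\<close> make \<open>close\<close>
    applicable. The third gives 2\<epsilon>(1 + \<open>R / d\<close>) < \<open>c / 2\<close>, where
    \<open>R / d\<close> bounds \<open>rp \<mu> / rm \<mu>\<close>; with two errors of
    \<open>c / 4\<close> from \<open>close\<close> the total stays below \<open>c\<close>.\<close>
  define \<epsilon>s where "\<epsilon>s = Min {1, e, c / (4 * (1 + R / d))}"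
  have den: "1 + R / d > 0"
    using \<open>R > 0\<close> \<open>d > 0\<close> by (simp add: add_pos_pos)
  show thesis
  proof (rule that[of \<epsilon>s])
    show "\<epsilon>s > 0"
      using \<open>e > 0\<close> \<open>c > 0\<close> den by (simp add: \<epsilon>s_def)
    fix \<mu> \<epsilon> bc N r \<phi> \<rho> i j
    assume \<mu>: "\<mu> \<in> {a..b}" and \<epsilon>: "\<epsilon> \<in> {0<..<\<epsilon>s}"
      and sol: "chain_solution lam \<omega> bc N \<mu> \<epsilon> r \<phi> \<rho>"
      and i: "i \<in> {1..N}" and j: "j \<in> {1..N}" and ri: "r i = rp \<mu>" and rj: "r j = rm \<mu>"
    have \<mu>01: "\<mu> \<in> {0<..<1}"
      using \<mu> ab by auto
    have eps: "\<epsilon> > 0" "\<epsilon> < min 1 e" "\<epsilon> < c / (4 * (1 + R / d))"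
      using \<epsilon> by (auto simp: \<epsilon>s_def)
    have "\<bar>\<omega> (rp \<mu>) \<mu> \<epsilon> - \<rho>\<bar> \<le> 2 * \<epsilon>"
      using chain_solution_frequency_near[OF A \<mu>01 eps(1) sol i] pos[OF \<mu>] unfolding ri by simp
    moreover have "\<bar>\<omega> (rm \<mu>) \<mu> \<epsilon> - \<rho>\<bar> \<le> 2 * \<epsilon> * (R / d)"
    proof -
      have "\<bar>\<omega> (rm \<mu>) \<mu> \<epsilon> - \<rho>\<bar> \<le> 2 * \<epsilon> * (rp \<mu> / rm \<mu>)"
        using chain_solution_frequency_near[OF A \<mu>01 eps(1) sol j] pos[OF \<mu>] unfolding rj by simp
      also have "\<dots> \<le> 2 * \<epsilon> * (R / d)"
        using dR[OF \<mu>] pos[OF \<mu>] \<open>d > 0\<close> \<open>R > 0\<close> eps(1) by (intro mult_left_mono frac_le) auto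
      finally show ?thesis .
    qed
    moreover have "\<bar>\<omega> (rp \<mu>) \<mu> \<epsilon> - \<omega> (rp \<mu>) \<mu> 0\<bar> < c / 4" "\<bar>\<omega> (rm \<mu>) \<mu> \<epsilon> - \<omega> (rm \<mu>) \<mu> 0\<bar> < c / 4"
      using dR[OF \<mu>] pos[OF \<mu>] \<mu> eps by (intro close; simp)+
    moreover have "2 * \<epsilon> + 2 * \<epsilon> * (R / d) < c / 2"
    proof -
      have "\<epsilon> * (4 * (1 + R / d)) < c"
        using eps(3) den by (subst (asm) pos_less_divide_eq) auto
      then show ?thesis
        by (simp add: algebra_simps)
    qed
    ultimately show False
      using c[OF \<mu>] by linarith
  qed
qed

section \<open>Fronts with a long plateau, as in (ii)\<close>

text \<open>If the site \<open>k + 1\<close> fixes a detuning away from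
  \<open>\<omega>1 p \<mu> 0\<close>, every plateau site changes the flux by a fixed amount in the
  same direction. The total change grows linearly in \<open>k\<close>, while the amplitudes bound
  the flux.\<close>

lemma no_front_solution:
  fixes \<omega>1 :: "real \<Rightarrow> real \<Rightarrow> real \<Rightarrow> real"
  assumes cont: "continuous_on UNIV (\<lambda>(r, \<mu>, \<epsilon>). \<omega>1 r \<mu> \<epsilon>)"
    and \<omega>: "\<And>r \<epsilon>. \<omega> r \<mu> \<epsilon> = \<omega>0 + \<epsilon> * \<omega>1 r \<mu> \<epsilon>"
    and pos: "0 < m" "0 < p" and gap: "p / m < \<bar>\<omega>1 m \<mu> 0 - \<omega>1 p \<mu> 0\<bar>"
  obtains ks :: nat and \<epsilon>s \<delta> where "\<epsilon>s > 0" "\<delta> > 0"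
    "\<And>k \<epsilon> bc N r \<phi> \<rho>. \<lbrakk>k \<ge> ks; \<epsilon> \<in> {0<..<\<epsilon>s}; N > k; chain_solution lam \<omega> bc N \<mu> \<epsilon> r \<phi> \<rho>;
      \<And>n. n \<in> {1..N} \<Longrightarrow> \<bar>r n - front_profile p m k n\<bar> < \<delta>\<rbrakk> \<Longrightarrow> False"
proof -
  \<comment> \<open>The surplus in the gap condition is spent in quarters: two at the site
    \<open>k + 1\<close> (the change of \<open>\<omega>1\<close> and the perturbed ratio
    \<open>p / m\<close>), one on the change of \<open>\<omega>1\<close> along the plateau. The last
    quarter drives the flux.\<close>
  define g where "g = \<bar>\<omega>1 m \<mu> 0 - \<omega>1 p \<mu> 0\<bar> - p / m"
  have "g > 0"
    using gap by (simp add: g_def)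
  have near: "\<exists>d>0. \<forall>x \<epsilon>. \<bar>x - y\<bar> < d \<longrightarrow> \<bar>\<epsilon>\<bar> < d \<longrightarrow> \<bar>\<omega>1 x \<mu> \<epsilon> - \<omega>1 y \<mu> 0\<bar> < g / 4" for y
  proof -
    have "continuous_on UNIV (\<lambda>q::real \<times> real. (fst q, \<mu>, snd q))"
      by (intro continuous_intros)
    then have "continuous_on UNIV (\<lambda>q. \<omega>1 (fst q) \<mu> (snd q))"
      using continuous_on_compose2[OF cont, of UNIV "\<lambda>q. (fst q, \<mu>, snd q)"] by simp
    then have "isCont (\<lambda>q. \<omega>1 (fst q) \<mu> (snd q)) (y, 0)"
      by (simp add: continuous_on_eq_continuous_at)
    then have "((\<lambda>q. \<omega>1 (fst q) \<mu> (snd q)) \<longlongrightarrow> \<omega>1 y \<mu> 0) (nhds y \<times>\<^sub>F nhds 0)"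
      using isCont_imp_tendsto_nhds by (fastforce simp: nhds_prod)
    then have "\<forall>\<^sub>F q in nhds y \<times>\<^sub>F nhds 0. dist (\<omega>1 (fst q) \<mu> (snd q)) (\<omega>1 y \<mu> 0) < g / 4"
      using \<open>g > 0\<close> by (intro tendstoD) auto
    then obtain P Q where P: "\<forall>\<^sub>F x in nhds y. P x" and Q: "\<forall>\<^sub>F \<epsilon> in nhds 0. Q \<epsilon>"
      and PQ: "\<And>x \<epsilon>. P x \<Longrightarrow> Q \<epsilon> \<Longrightarrow> \<bar>\<omega>1 x \<mu> \<epsilon> - \<omega>1 y \<mu> 0\<bar> < g / 4"
      by (auto simp: eventually_prod_filter dist_real_def)
    obtain d1 d2 where "d1 > 0" "d2 > 0" "\<And>x. \<bar>x - y\<bar> < d1 \<Longrightarrow> P x" "\<And>\<epsilon>. \<bar>\<epsilon>\<bar> < d2 \<Longrightarrow> Q \<epsilon>"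
      using P Q by (auto simp: eventually_nhds_metric dist_real_def)
    then show ?thesis
      using PQ by (intro exI[of _ "min d1 d2"]) auto
  qed
  obtain dp where "dp > 0" and dp: "\<And>x \<epsilon>. \<bar>x - p\<bar> < dp \<Longrightarrow> \<bar>\<epsilon>\<bar> < dp \<Longrightarrow> \<bar>\<omega>1 x \<mu> \<epsilon> - \<omega>1 p \<mu> 0\<bar> < g / 4"
    using near by blast
  obtain dm where "dm > 0" and dm: "\<And>x \<epsilon>. \<bar>x - m\<bar> < dm \<Longrightarrow> \<bar>\<epsilon>\<bar> < dm \<Longrightarrow> \<bar>\<omega>1 x \<mu> \<epsilon> - \<omega>1 m \<mu> 0\<bar> < g / 4"
    using near by blast
  \<comment> \<open>The quotient bounds the scaled detuning at the site \<open>k + 1\<close> when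
    all amplitudes are within \<open>t\<close> of the profile.\<close>
  have "((\<lambda>t. (p + 2 * t) / (m - t)) \<longlongrightarrow> (p + 2 * 0) / (m - 0)) (at_right 0)"
    using pos by (intro tendsto_intros) auto
  then have "\<forall>\<^sub>F t in at_right 0. (p + 2 * t) / (m - t) < p / m + g / 4"
    using \<open>g > 0\<close> by (intro order_tendstoD(2)) auto
  \<comment> \<open>\<open>dp\<close> and \<open>dm\<close> control \<open>\<omega>1\<close>,
    \<open>p / 2\<close> confines plateau amplitudes to \<open>[p / 2, 2 * p]\<close>, and
    \<open>m\<close> keeps the denominator positive.\<close>
  moreover have "\<forall>\<^sub>F t in at_right 0. t \<in> {0<..<Min {dp, dm, p / 2, m}}"
    using \<open>dp > 0\<close> \<open>dm > 0\<close> pos by (intro eventually_at_right_real) auto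
  ultimately have "\<forall>\<^sub>F t in at_right 0. (p + 2 * t) / (m - t) < p / m + g / 4 \<and>
      t \<in> {0<..<Min {dp, dm, p / 2, m}}"
    by (rule eventually_conj)
  then obtain \<delta> where \<delta>: "(p + 2 * \<delta>) / (m - \<delta>) < p / m + g / 4"
    "\<delta> > 0" "\<delta> < dp" "\<delta> < dm" "\<delta> < p / 2" "\<delta> < m"
    by (auto dest!: eventually_happens)
  \<comment> \<open>The \<open>k - 2\<close> sites used on the plateau each add at least
    \<open>g / 4 * (p / 2)\<^sup>2\<close> to a flux difference of at most
    \<open>8 * p\<^sup>2\<close>, so a solution would need
    \<open>(k - 2) * g \<le> 128\<close>.\<close>
  obtain ks :: nat where ks: "128 / g + 2 < real ks"
    using reals_Archimedean2 by blast
  show thesis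
  proof (rule that[of "min dp dm" \<delta> ks])
    show "min dp dm > 0" "\<delta> > 0"
      using \<open>dp > 0\<close> \<open>dm > 0\<close> \<delta> by auto
    fix k \<epsilon> bc N r \<phi> \<rho>
    assume k: "k \<ge> ks" and \<epsilon>: "\<epsilon> \<in> {0<..<min dp dm}" and N: "N > k"
      and sol: "chain_solution lam \<omega> bc N \<mu> \<epsilon> r \<phi> \<rho>"
      and prof: "\<And>n. n \<in> {1..N} \<Longrightarrow> \<bar>r n - front_profile p m k n\<bar> < \<delta>"
    have kg: "128 / g < real k - 2"
      using ks k by linarith
    moreover have "128 / g > 0"
      using \<open>g > 0\<close> by simp
    ultimately have k2: "k > 2"
      by linarith
    have rp: "\<bar>r n - p\<bar> < \<delta>" if "n \<in> {1..k}" for n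
      using prof[of n] N that by (auto simp: front_profile_def)
    have rm: "\<bar>r (k + 1) - m\<bar> < \<delta>"
      using prof[of "k + 1"] N by (auto simp: front_profile_def)
    \<comment> \<open>The detuning on the scale of \<epsilon>, so that dividing the imaginary parts
      by \<epsilon> leaves relations of order one.\<close>
    define P where "P = (\<rho> - \<omega>0) / \<epsilon>"
    have balance: "(\<omega>1 (r n) \<mu> \<epsilon> - P) * r n = r (n - 1) * sin (\<phi> (n - 1)) - r (n + 1) * sin (\<phi> n)"
      if "n \<in> {1..N}" for n
    proof -
      have "\<rho> = \<omega>0 + \<epsilon> * P"
        using \<epsilon> by (simp add: P_def)
      then have "\<epsilon> * ((\<omega>1 (r n) \<mu> \<epsilon> - P) * r n) = \<epsilon> * (r (n - 1) * sin (\<phi> (n - 1)) - r (n + 1) * sin (\<phi> n))"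
        using chain_solution_Re_Im(2)[OF sol that] unfolding \<omega> by algebra
      then show ?thesis
        using \<epsilon> by simp
    qed
    have "\<bar>\<omega>1 m \<mu> 0 - P\<bar> < p / m + g / 2"
    proof -
      have "\<bar>r k * sin (\<phi> k)\<bar> \<le> \<bar>r k\<bar>" "\<bar>r (k + 2) * sin (\<phi> (k + 1))\<bar> \<le> \<bar>r (k + 2)\<bar>"
        by (simp_all add: abs_mult mult_left_le)
      moreover have "\<bar>r k\<bar> \<le> p + \<delta>"
        using rp[of k] k2 pos by auto
      \<comment> \<open>If \<open>k + 1\<close> is the last site, its right neighbour is a ghost
        value near \<open>m\<close>, which need not be small; the term then vanishes because
        \<open>\<phi> N = 0\<close>.\<close>
      moreover have "\<bar>r (k + 2) * sin (\<phi> (k + 1))\<bar> \<le> \<delta>"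
      proof (cases "N = k + 1")
        case True
        then show ?thesis
          using sol \<delta> by (simp add: chain_solution_def boundary_conditions_def)
      next
        case False
        then have "\<bar>r (k + 2)\<bar> < \<delta>"
          using prof[of "k + 2"] N by (auto simp: front_profile_def)
        then show ?thesis
          using \<open>\<bar>r (k + 2) * sin (\<phi> (k + 1))\<bar> \<le> \<bar>r (k + 2)\<bar>\<close> by linarith
      qed
      ultimately have "\<bar>r k * sin (\<phi> k) - r (k + 2) * sin (\<phi> (k + 1))\<bar> \<le> p + 2 * \<delta>"
        by linarith
      then have "\<bar>\<omega>1 (r (k + 1)) \<mu> \<epsilon> - P\<bar> * \<bar>r (k + 1)\<bar> \<le> p + 2 * \<delta>"
        using balance[of "k + 1"] N by (simp flip: abs_mult)
      moreover have "m - \<delta> \<le> \<bar>r (k + 1)\<bar>"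
        using rm by linarith
      ultimately have "\<bar>\<omega>1 (r (k + 1)) \<mu> \<epsilon> - P\<bar> * (m - \<delta>) \<le> p + 2 * \<delta>"
        by (meson abs_ge_zero mult_left_mono order_trans)
      then have "\<bar>\<omega>1 (r (k + 1)) \<mu> \<epsilon> - P\<bar> \<le> (p + 2 * \<delta>) / (m - \<delta>)"
        using \<delta> by (simp add: pos_le_divide_eq)
      moreover have "\<bar>\<omega>1 (r (k + 1)) \<mu> \<epsilon> - \<omega>1 m \<mu> 0\<bar> < g / 4"
        using rm \<delta> \<epsilon> by (intro dm) auto
      ultimately show ?thesis
        using \<delta>(1) by linarith
    qed
    then have q: "\<bar>\<omega>1 p \<mu> 0 - P\<bar> > g / 2"
      using g_def by linarith
    define J where "J n = r n * r (n + 1) * sin (\<phi> n)" for n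
    have r_bounds: "p / 2 \<le> r n" "r n \<le> 2 * p" if "n \<in> {1..k}" for n
      using rp[OF that] \<delta> pos by auto
    have J: "\<bar>J n\<bar> \<le> 4 * p\<^sup>2" if "n \<in> {1..<k}" for n
    proof -
      have "\<bar>J n\<bar> \<le> \<bar>r n\<bar> * \<bar>r (n + 1)\<bar>"
        by (simp add: J_def abs_mult mult_left_le)
      also have "\<dots> \<le> (2 * p) * (2 * p)"
        using r_bounds[of n] r_bounds[of "n + 1"] that pos by (intro mult_mono) auto
      finally show ?thesis
        by (simp add: power2_eq_square)
    qed
    \<comment> \<open>The sign makes all flux increments positive, so that they cannot cancel in the
      sum.\<close>
    define \<sigma> where "\<sigma> = sgn (\<omega>1 p \<mu> 0 - P)"
    \<comment> \<open>Restricting \<open>n\<close> to \<open>2, ..., k - 1\<close> keeps both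
      \<open>J n\<close> and \<open>J (n - 1)\<close> between plateau sites, where \<open>J\<close>
      is bounded.\<close>
    have summand: "g / 4 * (p / 2)\<^sup>2 \<le> - \<sigma> * (J n - J (n - 1))" if "n \<in> {Suc 1..k - 1}" for n
    proof -
      have n: "n \<in> {1..k}" "n \<in> {1..N}" "n - 1 + 1 = n"
        using that N by auto
      have "\<bar>\<omega>1 (r n) \<mu> \<epsilon> - \<omega>1 p \<mu> 0\<bar> < g / 4"
        using rp[OF n(1)] \<delta> \<epsilon> by (intro dp) auto
      then have "g / 4 \<le> \<sigma> * (\<omega>1 (r n) \<mu> \<epsilon> - P)"
        using q \<open>g > 0\<close> by (auto simp: \<sigma>_def sgn_if abs_if split: if_splits)
      then have "g / 4 * (p / 2)\<^sup>2 \<le> (\<sigma> * (\<omega>1 (r n) \<mu> \<epsilon> - P)) * (r n)\<^sup>2"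
        using r_bounds(1)[OF n(1)] pos \<open>g > 0\<close> by (intro mult_mono power_mono) auto
      also have "\<dots> = - \<sigma> * (J n - J (n - 1))"
        using balance[OF n(2)] unfolding J_def n(3) by algebra
      finally show ?thesis .
    qed
    have "real (k - 2) * (g / 4 * (p / 2)\<^sup>2) \<le> (\<Sum>n\<in>{Suc 1..k - 1}. - \<sigma> * (J n - J (n - 1)))"
      using sum_bounded_below[OF summand, of "{Suc 1..k - 1}" "\<lambda>n. n"] by (simp add: numeral_2_eq_2)
    also have "\<dots> = - \<sigma> * (J (k - 1) - J 1)"
      using sum_telescope''[of 1 "k - 1" J] k2 by (subst sum_distrib_left[symmetric]) auto
    also have "\<dots> \<le> \<bar>J (k - 1) - J 1\<bar>"
      by (auto simp: \<sigma>_def sgn_if)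
    also have "\<dots> \<le> 8 * p\<^sup>2"
    proof -
      have "\<bar>J (k - 1)\<bar> \<le> 4 * p\<^sup>2" "\<bar>J 1\<bar> \<le> 4 * p\<^sup>2"
        using k2 by (auto intro!: J)
      then show ?thesis
        by linarith
    qed
    finally have "(real k - 2) * g * p\<^sup>2 \<le> 128 * p\<^sup>2"
      using k2 by (simp add: of_nat_diff power2_eq_square algebra_simps)
    then have "(real k - 2) * g \<le> 128"
      using pos by simp
    then show False
      using kg \<open>g > 0\<close> by (simp add: pos_divide_less_eq)
  qed
qed

section \<open>Assembly of (i) at one parameter, (i) on closed intervals, and (ii)\<close>

theorem lemma2p3:
  fixes lam :: "real \<Rightarrow> real \<Rightarrow> real"
    and rm rp :: "real \<Rightarrow> real"
    and \<omega> :: "real \<Rightarrow> real \<Rightarrow> real \<Rightarrow> real"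
  assumes A: "hypothesis_A lam rm rp"
    and smooth_\<omega>: "smooth (\<lambda>(r, \<mu>, \<epsilon>). \<omega> r \<mu> \<epsilon>)"
  shows
    "(\<forall>\<mu>\<in>{0<..<1}. \<omega> (rm \<mu>) \<mu> 0 \<noteq> \<omega> (rp \<mu>) \<mu> 0 \<longrightarrow>
        (\<exists>\<epsilon>s>0. \<forall>\<epsilon>\<in>{0<..<\<epsilon>s}. \<forall>bc. \<forall>N\<ge>1.
           \<not> (\<exists>r \<phi> \<rho>. chain_solution lam \<omega> bc N \<mu> \<epsilon> r \<phi> \<rho> \<and>
                (\<exists>i\<in>{1..N}. \<exists>j\<in>{1..N}. r i = rp \<mu> \<and> r j = rm \<mu>))))
     \<and>
     (\<forall>a b. 0 < a \<and> a \<le> b \<and> b < 1 \<and>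
        (\<exists>c>0. \<forall>\<mu>\<in>{a..b}. c \<le> \<bar>\<omega> (rm \<mu>) \<mu> 0 - \<omega> (rp \<mu>) \<mu> 0\<bar>) \<longrightarrow>
        (\<exists>\<epsilon>s>0. \<forall>\<mu>\<in>{a..b}. \<forall>\<epsilon>\<in>{0<..<\<epsilon>s}. \<forall>bc. \<forall>N\<ge>1.
           \<not> (\<exists>r \<phi> \<rho>. chain_solution lam \<omega> bc N \<mu> \<epsilon> r \<phi> \<rho> \<and>
                (\<exists>i\<in>{1..N}. \<exists>j\<in>{1..N}. r i = rp \<mu> \<and> r j = rm \<mu>))))
     \<and>
     (\<forall>\<omega>0 \<omega>1. smooth \<omega>0 \<and> smooth (\<lambda>(r, \<mu>, \<epsilon>). \<omega>1 r \<mu> \<epsilon>) \<and>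
        (\<forall>r \<mu> \<epsilon>. \<omega> r \<mu> \<epsilon> = \<omega>0 \<mu> + \<epsilon> * \<omega>1 r \<mu> \<epsilon>) \<longrightarrow>
        (\<forall>\<mu>\<in>{0<..<1}. rp \<mu> / rm \<mu> < \<bar>\<omega>1 (rm \<mu>) \<mu> 0 - \<omega>1 (rp \<mu>) \<mu> 0\<bar> \<longrightarrow>
           (\<exists>ks::nat. \<exists>\<epsilon>s>0. \<exists>\<delta>>0. \<forall>k\<ge>ks. \<forall>\<epsilon>\<in>{0<..<\<epsilon>s}. \<forall>bc. \<forall>N>k.
              \<not> (\<exists>r \<phi> \<rho>. chain_solution lam \<omega> bc N \<mu> \<epsilon> r \<phi> \<rho> \<and>
                   (\<forall>n\<in>{1..N}. \<bar>r n - front_profile (rp \<mu>) (rm \<mu>) k n\<bar> < \<delta>)))))"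
proof (intro conjI allI impI ballI)
  fix \<mu> :: real
  assume \<mu>: "\<mu> \<in> {0<..<1}" and "\<omega> (rm \<mu>) \<mu> 0 \<noteq> \<omega> (rp \<mu>) \<mu> 0"
  then have gap: "0 < \<bar>\<omega> (rm \<mu>) \<mu> 0 - \<omega> (rp \<mu>) \<mu> 0\<bar>"
    by simp
  \<comment> \<open>A single \<mu> is the degenerate interval \<open>{\<mu>..\<mu>}\<close>, with
    the frequency gap itself as the uniform constant.\<close>
  obtain \<epsilon>s where "\<epsilon>s > 0"
    "\<And>\<nu> \<epsilon> bc N r \<phi> \<rho> i j. \<lbrakk>\<nu> \<in> {\<mu>..\<mu>}; \<epsilon> \<in> {0<..<\<epsilon>s}; chain_solution lam \<omega> bc N \<nu> \<epsilon> r \<phi> \<rho>;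
      i \<in> {1..N}; j \<in> {1..N}; r i = rp \<nu>; r j = rm \<nu>\<rbrakk> \<Longrightarrow> False"
    by (rule no_mixed_solution_uniform[OF A smooth_imp_continuous_on[OF smooth_\<omega>] _ _ _ gap, of \<mu> \<mu>]) (use \<mu> in auto)
  then show "\<exists>\<epsilon>s>0. \<forall>\<epsilon>\<in>{0<..<\<epsilon>s}. \<forall>bc. \<forall>N\<ge>1.
         \<not> (\<exists>r \<phi> \<rho>. chain_solution lam \<omega> bc N \<mu> \<epsilon> r \<phi> \<rho> \<and>
              (\<exists>i\<in>{1..N}. \<exists>j\<in>{1..N}. r i = rp \<mu> \<and> r j = rm \<mu>))"
    by (intro exI[of _ \<epsilon>s]) force
next
  fix a b :: real
  assume ab: "0 < a \<and> a \<le> b \<and> b < 1 \<and>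
      (\<exists>c>0. \<forall>\<mu>\<in>{a..b}. c \<le> \<bar>\<omega> (rm \<mu>) \<mu> 0 - \<omega> (rp \<mu>) \<mu> 0\<bar>)"
  then obtain c where c: "c > 0" "\<And>\<mu>. \<mu> \<in> {a..b} \<Longrightarrow> c \<le> \<bar>\<omega> (rm \<mu>) \<mu> 0 - \<omega> (rp \<mu>) \<mu> 0\<bar>"
    by blast
  obtain \<epsilon>s where "\<epsilon>s > 0"
    "\<And>\<mu> \<epsilon> bc N r \<phi> \<rho> i j. \<lbrakk>\<mu> \<in> {a..b}; \<epsilon> \<in> {0<..<\<epsilon>s}; chain_solution lam \<omega> bc N \<mu> \<epsilon> r \<phi> \<rho>;
      i \<in> {1..N}; j \<in> {1..N}; r i = rp \<mu>; r j = rm \<mu>\<rbrakk> \<Longrightarrow> False"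
    by (rule no_mixed_solution_uniform[OF A smooth_imp_continuous_on[OF smooth_\<omega>] _ _ _ c]) (use ab in auto)
  then show "\<exists>\<epsilon>s>0. \<forall>\<mu>\<in>{a..b}. \<forall>\<epsilon>\<in>{0<..<\<epsilon>s}. \<forall>bc. \<forall>N\<ge>1.
         \<not> (\<exists>r \<phi> \<rho>. chain_solution lam \<omega> bc N \<mu> \<epsilon> r \<phi> \<rho> \<and>
              (\<exists>i\<in>{1..N}. \<exists>j\<in>{1..N}. r i = rp \<mu> \<and> r j = rm \<mu>))"
    by (intro exI[of _ \<epsilon>s]) blast
next
  fix \<omega>0 \<omega>1 and \<mu> :: real
  assume \<omega>1: "smooth \<omega>0 \<and> smooth (\<lambda>(r, \<mu>, \<epsilon>). \<omega>1 r \<mu> \<epsilon>) \<and>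
      (\<forall>r \<mu> \<epsilon>. \<omega> r \<mu> \<epsilon> = \<omega>0 \<mu> + \<epsilon> * \<omega>1 r \<mu> \<epsilon>)"
    and \<mu>: "\<mu> \<in> {0<..<1}" and gap: "rp \<mu> / rm \<mu> < \<bar>\<omega>1 (rm \<mu>) \<mu> 0 - \<omega>1 (rp \<mu>) \<mu> 0\<bar>"
  have cont1: "continuous_on UNIV (\<lambda>(r, \<mu>, \<epsilon>). \<omega>1 r \<mu> \<epsilon>)"
    using \<omega>1 smooth_imp_continuous_on by blast
  obtain ks :: nat and \<epsilon>s \<delta> where "\<epsilon>s > 0" "\<delta> > 0"
    "\<And>k \<epsilon> bc N r \<phi> \<rho>. \<lbrakk>k \<ge> ks; \<epsilon> \<in> {0<..<\<epsilon>s}; N > k; chain_solution lam \<omega> bc N \<mu> \<epsilon> r \<phi> \<rho>;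
      \<And>n. n \<in> {1..N} \<Longrightarrow> \<bar>r n - front_profile (rp \<mu>) (rm \<mu>) k n\<bar> < \<delta>\<rbrakk> \<Longrightarrow> False"
    by (rule no_front_solution[OF cont1 _ hypothesis_A_roots_pos(1,3)[OF A \<mu>] gap, of \<omega> "\<omega>0 \<mu>" lam])
      (use \<omega>1 in auto)
  then show "\<exists>ks::nat. \<exists>\<epsilon>s>0. \<exists>\<delta>>0. \<forall>k\<ge>ks. \<forall>\<epsilon>\<in>{0<..<\<epsilon>s}. \<forall>bc. \<forall>N>k.
            \<not> (\<exists>r \<phi> \<rho>. chain_solution lam \<omega> bc N \<mu> \<epsilon> r \<phi> \<rho> \<and>
                 (\<forall>n\<in>{1..N}. \<bar>r n - front_profile (rp \<mu>) (rm \<mu>) k n\<bar> < \<delta>))"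
    by (intro exI[of _ ks] exI[of _ \<epsilon>s] exI[of _ \<delta>]) blast
qed

end
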